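(* Let $A$ be a reduced mp-ring. Then the pure ideals of $A$ are precisely the ideals of the form $\bigcap_{\mathfrak{p}\in\operatorname{Min}(A)\cap E}\mathfrak{p}$, where $E$ is a flat closed subset of $\operatorname{Spec}(A)$.
   Context: All rings are commutative (with unit). A ring is a mp-ring if each of its prime ideals contains a unique minimal prime ideal. An ideal $I$ of $A$ is pure if the canonical ring map $A\to A/I$ is flat. $\operatorname{Min}(A)$ is the set of minimal prime ideals. The flat (or inverse) topology on $\operatorname{Spec}(A)$ is the topology for which the sets $V(f)=\{\mathfrak{p}\in\operatorname{Spec}(A): f\in\mathfrak{p}\}$, $f\in A$, form a sub-basis of opens; "flat closed" means closed in this topology. The empty intersection of ideals is $A$. *)

theory Defs
  imports "HOL-Algebra.Algebra" "HOL-Algebra.Free_Abelian_Groups" "HOL-Analysis.Abstract_Topology"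
begin

section \<open>Tensor products and flatness\<close>

definition module_hom ::
  "('a, 'm) ring_scheme \<Rightarrow> ('a, 'b, 'k) module_scheme \<Rightarrow> ('a, 'c, 'l) module_scheme \<Rightarrow> ('b \<Rightarrow> 'c) set"
  where "module_hom R M N =
    {g. g \<in> carrier M \<rightarrow> carrier N \<and>
         (\<forall>x\<in>carrier M. \<forall>y\<in>carrier M. g (x \<oplus>\<^bsub>M\<^esub> y) = g x \<oplus>\<^bsub>N\<^esub> g y) \<and>
         (\<forall>r\<in>carrier R. \<forall>x\<in>carrier M. g (r \<odot>\<^bsub>M\<^esub> x) = r \<odot>\<^bsub>N\<^esub> g x)}"

text \<open>
  The tensor product of two modules over a commutative ring is the free abelian group on the
  pairs modulo the bilinearity relations. Only its group structure is needed below, since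
  injectivity of an induced map does not involve the scalar action.
\<close>

definition tensor_relators ::
  "('a, 'm) ring_scheme \<Rightarrow> ('a, 'b, 'k) module_scheme \<Rightarrow> ('a, 'c, 'l) module_scheme \<Rightarrow> ('b \<times> 'c \<Rightarrow>\<^sub>0 int) set"
  where "tensor_relators R M N =
      {frag_of (x \<oplus>\<^bsub>M\<^esub> x', y) - frag_of (x, y) - frag_of (x', y) | x x' y.
         x \<in> carrier M \<and> x' \<in> carrier M \<and> y \<in> carrier N}
    \<union> {frag_of (x, y \<oplus>\<^bsub>N\<^esub> y') - frag_of (x, y) - frag_of (x, y') | x y y'.
         x \<in> carrier M \<and> y \<in> carrier N \<and> y' \<in> carrier N}
    \<union> {frag_of (r \<odot>\<^bsub>M\<^esub> x, y) - frag_of (x, r \<odot>\<^bsub>N\<^esub> y) | r x y.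
         r \<in> carrier R \<and> x \<in> carrier M \<and> y \<in> carrier N}"

definition tensor_kernel ::
  "('a, 'm) ring_scheme \<Rightarrow> ('a, 'b, 'k) module_scheme \<Rightarrow> ('a, 'c, 'l) module_scheme \<Rightarrow> ('b \<times> 'c \<Rightarrow>\<^sub>0 int) set"
  where "tensor_kernel R M N =
    generate (free_Abelian_group (carrier M \<times> carrier N)) (tensor_relators R M N)"

definition tensor_product ::
  "('a, 'm) ring_scheme \<Rightarrow> ('a, 'b, 'k) module_scheme \<Rightarrow> ('a, 'c, 'l) module_scheme \<Rightarrow> ('b \<times> 'c \<Rightarrow>\<^sub>0 int) set monoid"
  where "tensor_product R M N =
    free_Abelian_group (carrier M \<times> carrier N) Mod tensor_kernel R M N"

text \<open>
  The map from the tensor product of \<open>M\<close> and \<open>N'\<close> to that of \<open>M\<close> and \<open>N\<close> induced by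
  \<open>g : N' \<rightarrow> N\<close>, as a map on cosets. The union is over representatives, whose images all give the
  same coset if \<open>g\<close> is linear: see \<open>tensor_map_coset\<close> below.
\<close>

definition free_map :: "('c \<Rightarrow> 'd) \<Rightarrow> ('b \<times> 'c \<Rightarrow>\<^sub>0 int) \<Rightarrow> ('b \<times> 'd \<Rightarrow>\<^sub>0 int)"
  where "free_map g = frag_extend (\<lambda>(x, y). frag_of (x, g y))"

definition tensor_map ::
  "('a, 'm) ring_scheme \<Rightarrow> ('a, 'b, 'k) module_scheme \<Rightarrow> ('a, 'd, 'l) module_scheme \<Rightarrow> ('c \<Rightarrow> 'd) \<Rightarrow>
   ('b \<times> 'c \<Rightarrow>\<^sub>0 int) set \<Rightarrow> ('b \<times> 'd \<Rightarrow>\<^sub>0 int) set"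
  where "tensor_map R M N g C =
    (\<Union>t\<in>C. tensor_kernel R M N #>\<^bsub>free_Abelian_group (carrier M \<times> carrier N)\<^esub> free_map g t)"

text \<open>
  Flatness: tensoring with \<open>M\<close> preserves injectivity of linear maps. A definition in HOL cannot
  quantify over all types, so the test modules range over all modules whose carrier lies in a
  type \<open>'u\<close>, which plays the role of a universe and is a parameter of the definition. As soon as
  \<open>'u\<close> has at least as many elements as \<open>R\<close>, the notion does not depend on \<open>'u\<close>: all inclusions
  of ideals of \<open>R\<close> into \<open>R\<close> then occur among the test maps up to isomorphism, and these detect
  flatness.
\<close>

definition flat_module ::
  "'u itself \<Rightarrow> ('a, 'm) ring_scheme \<Rightarrow> ('a, 'b, 'k) module_scheme \<Rightarrow> bool"
  where "flat_module U R M \<longleftrightarrow> module R M \<and>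
    (\<forall>(N' :: ('a, 'u) module) (N :: ('a, 'u) module) g.
       module R N' \<and> module R N \<and> g \<in> module_hom R N' N \<and> inj_on g (carrier N') \<longrightarrow>
       inj_on (tensor_map R M N g) (carrier (tensor_product R M N')))"

definition restrict_scalars ::
  "('b, 'n) ring_scheme \<Rightarrow> ('a \<Rightarrow> 'b) \<Rightarrow> ('a, 'b) module"
  where "restrict_scalars S h =
    \<lparr>carrier = carrier S, monoid.mult = monoid.mult S, monoid.one = monoid.one S, ring.zero = ring.zero S, ring.add = ring.add S,
     smult = (\<lambda>r x. h r \<otimes>\<^bsub>S\<^esub> x)\<rparr>"

definition flat_ring_hom ::
  "'u itself \<Rightarrow> ('a, 'm) ring_scheme \<Rightarrow> ('b, 'n) ring_scheme \<Rightarrow> ('a \<Rightarrow> 'b) \<Rightarrow> bool"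
  where "flat_ring_hom U R S h \<longleftrightarrow>
    h \<in> ring_hom R S \<and> flat_module U R (restrict_scalars S h)"

definition pure_ideal :: "'u itself \<Rightarrow> ('a, 'm) ring_scheme \<Rightarrow> 'a set \<Rightarrow> bool"
  where "pure_ideal U R I \<longleftrightarrow>
    ideal I R \<and> flat_ring_hom U R (R Quot I) (\<lambda>a. I +>\<^bsub>R\<^esub> a)"


section \<open>The prime spectrum\<close>

definition Spec :: "('a, 'm) ring_scheme \<Rightarrow> 'a set set"
  where "Spec R = {P. primeideal P R}"

definition Min_Spec :: "('a, 'm) ring_scheme \<Rightarrow> 'a set set"
  where "Min_Spec R = {P \<in> Spec R. \<forall>Q\<in>Spec R. Q \<subseteq> P \<longrightarrow> Q = P}"

definition flat_topology :: "('a, 'm) ring_scheme \<Rightarrow> 'a set topology"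
  where "flat_topology R = topology_generated_by {{P \<in> Spec R. f \<in> P} | f. f \<in> carrier R}"

definition reduced_ring :: "('a, 'm) ring_scheme \<Rightarrow> bool"
  where "reduced_ring R \<longleftrightarrow> cring R \<and>
    (\<forall>a\<in>carrier R. \<forall>n::nat. a [^]\<^bsub>R\<^esub> n = \<zero>\<^bsub>R\<^esub> \<longrightarrow> a = \<zero>\<^bsub>R\<^esub>)"

definition mp_ring :: "('a, 'm) ring_scheme \<Rightarrow> bool"
  where "mp_ring R \<longleftrightarrow> cring R \<and> (\<forall>P\<in>Spec R. \<exists>!Q. Q \<in> Min_Spec R \<and> Q \<subseteq> P)"


section \<open>Sanity checks\<close>

lemma topspace_flat_topology:
  assumes "cring R"
  shows "topspace (flat_topology R) = Spec R"
proof -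
  interpret cring R by fact
  have "\<zero>\<^bsub>R\<^esub> \<in> P" if "P \<in> Spec R" for P
    using that additive_subgroup.zero_closed ideal.axioms(1) primeideal.axioms(1)
    unfolding Spec_def by blast
  then show ?thesis
    unfolding flat_topology_def by auto
qed

lemma tensor_relators_subset:
  assumes "module R M" "module R N"
  shows "tensor_relators R M N \<subseteq> carrier (free_Abelian_group (carrier M \<times> carrier N))"
proof -
  interpret M: module R M by fact
  interpret N: module R N by fact
  show ?thesis
    unfolding tensor_relators_def by (auto dest!: subsetD[OF keys_diff])
qed

lemma subgroup_tensor_kernel:
  assumes "module R M" "module R N"
  shows "subgroup (tensor_kernel R M N) (free_Abelian_group (carrier M \<times> carrier N))"
  unfolding tensor_kernel_def
  by (intro group.generate_is_subgroup tensor_relators_subset assms) simp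

lemma free_map_hom:
  assumes "g \<in> module_hom R N' N"
  shows "free_map g \<in> hom (free_Abelian_group (carrier M \<times> carrier N'))
    (free_Abelian_group (carrier M \<times> carrier N))"
proof (rule homI)
  fix t assume "t \<in> carrier (free_Abelian_group (carrier M \<times> carrier N'))"
  then have "Poly_Mapping.keys t \<subseteq> carrier M \<times> carrier N'" by simp
  then show "free_map g t \<in> carrier (free_Abelian_group (carrier M \<times> carrier N))"
    using assms unfolding free_map_def module_hom_def
    by (auto dest!: subsetD[OF keys_frag_extend])
qed (simp add: free_map_def frag_extend_add)

lemma free_map_tensor_kernel:
  assumes "module R M" "module R N'" "module R N" "g \<in> module_hom R N' N"
    and "t \<in> tensor_kernel R M N'"
  shows "free_map g t \<in> tensor_kernel R M N"
proof -
  interpret K: subgroup "tensor_kernel R M N" "free_Abelian_group (carrier M \<times> carrier N)"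
    by (rule subgroup_tensor_kernel) fact+
  have rel: "free_map g h \<in> tensor_relators R M N" if "h \<in> tensor_relators R M N'" for h
    using that assms(4) unfolding tensor_relators_def
    apply (elim UnE CollectE exE conjE)
    subgoal by (rule UnI1, rule UnI1)
        (auto simp: module_hom_def free_map_def frag_extend_diff)
    subgoal by (rule UnI1, rule UnI2)
        (auto simp: module_hom_def free_map_def frag_extend_diff)
    subgoal by (rule UnI2) (auto simp: module_hom_def free_map_def frag_extend_diff)
    done
  have rel': "h \<in> carrier (free_Abelian_group (carrier M \<times> carrier N'))"
    if "h \<in> tensor_relators R M N'" for h
    using that tensor_relators_subset assms by blast
  show ?thesis
    using assms(5) unfolding tensor_kernel_def[of R M N']
  proof (induction t rule: generate.induct)
    case one
    show ?case using K.one_closed by (simp add: free_map_def)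
  next
    case (incl h)
    then show ?case using rel unfolding tensor_kernel_def by (blast intro: generate.incl)
  next
    case (inv h)
    have "free_map g h \<in> tensor_kernel R M N"
      using rel[OF inv] unfolding tensor_kernel_def by (blast intro: generate.incl)
    then have "- free_map g h \<in> tensor_kernel R M N"
      using K.m_inv_closed K.mem_carrier inv_free_Abelian_group carrier_free_Abelian_group_iff
      by metis
    with rel'[OF inv] show ?case
      by (simp add: free_map_def frag_extend_minus)
  next
    case (eng h1 h2)
    then show ?case using K.m_closed by (simp add: free_map_def frag_extend_add)
  qed
qed

lemma tensor_map_coset:
  assumes "module R M" "module R N'" "module R N" "g \<in> module_hom R N' N"
    and t: "t \<in> carrier (free_Abelian_group (carrier M \<times> carrier N'))"
  shows "tensor_map R M N g (tensor_kernel R M N' #>\<^bsub>free_Abelian_group (carrier M \<times> carrier N')\<^esub> t)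
    = tensor_kernel R M N #>\<^bsub>free_Abelian_group (carrier M \<times> carrier N)\<^esub> free_map g t"
proof -
  let ?F = "free_Abelian_group (carrier M \<times> carrier N)"
  interpret F: group ?F by simp
  interpret K: subgroup "tensor_kernel R M N" ?F
    by (rule subgroup_tensor_kernel) fact+
  interpret K': subgroup "tensor_kernel R M N'" "free_Abelian_group (carrier M \<times> carrier N')"
    by (rule subgroup_tensor_kernel) fact+
  have ft: "free_map g t \<in> carrier ?F"
    using free_map_hom[OF assms(4)] t by (blast dest: hom_in_carrier)
  have "tensor_kernel R M N #>\<^bsub>?F\<^esub> free_map g (k + t) = tensor_kernel R M N #>\<^bsub>?F\<^esub> free_map g t"
    if "k \<in> tensor_kernel R M N'" for k
  proof -
    have "free_map g (k + t) = free_map g k \<otimes>\<^bsub>?F\<^esub> free_map g t"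
      by (simp add: free_map_def frag_extend_add)
    then have "free_map g (k + t) \<in> tensor_kernel R M N #>\<^bsub>?F\<^esub> free_map g t"
      using free_map_tensor_kernel[OF assms(1-4) that] unfolding r_coset_def by blast
    then show ?thesis
      using F.repr_independence[OF _ ft K.subgroup_axioms] by metis
  qed
  then show ?thesis
    using K'.one_closed unfolding tensor_map_def
    by (auto simp: r_coset_def[of "free_Abelian_group (carrier M \<times> carrier N')"])
qed

end

theory Submission
  imports Defs "HOL-Analysis.Function_Topology"
begin

text \<open>
An ideal \<open>I\<close> of a commutative ring \<open>A\<close> is pure if and only if it is s-unital: every \<open>a \<in> I\<close> can be
written as \<open>a = b a\<close> with \<open>b \<in> I\<close> (\<open>pure_ideal_iff_s_unital\<close>). One direction tests flatness of \<open>A/I\<close> on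
the inclusion of \<open>A a\<close> into \<open>A\<close>; the other uses that \<open>1 \<otimes> y\<close> vanishes in \<open>A/I \<otimes> N\<close> exactly if \<open>y\<close> is
fixed by an element of \<open>I\<close>, a condition that injective linear maps reflect. This turns the theorem
into a statement about elements and primes.

If \<open>I\<close> is s-unital, then \<open>a (1 - b) = 0\<close> shows that a prime contains \<open>I\<close> exactly if it contains no
\<open>1 - b\<close> with \<open>b \<in> I\<close>. Hence \<open>V(I)\<close> is an intersection of complements of basic opens and is flat
closed. The same equation shows that \<open>I\<close> is a radical ideal, because \<open>A\<close> is reduced. So \<open>I\<close> is the
intersection of the primes in \<open>V(I)\<close>; as flat closed sets are stable under passing to smaller primes,
the minimal primes in \<open>V(I)\<close> already have this intersection (\<open>flat_closed_of_s_unital\<close>).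

Conversely let \<open>E\<close> be flat closed, \<open>J\<close> the intersection of the minimal primes in \<open>E\<close>, and \<open>a \<in> J\<close>. It
suffices that \<open>Ann(a) + J = A\<close>, for then \<open>1 = s + b\<close> with \<open>s a = 0\<close> and \<open>b \<in> J\<close>. Otherwise some
prime \<open>M\<close> contains \<open>Ann(a) + J\<close>. Let \<open>p\<close> be the minimal prime below \<open>M\<close>. Since \<open>p\<close> is the only one,
the localization of \<open>A\<close> at \<open>M\<close> is a domain, and \<open>p\<close> is the kernel of the map to it
(\<open>minimal_prime_annihilator\<close>); as \<open>Ann(a) \<subseteq> M\<close>, it follows that \<open>a \<notin> p\<close>, so \<open>p \<notin> E\<close>. A member of \<open>E\<close> below
\<open>M\<close> would contain \<open>p\<close> and force \<open>p \<in> E\<close>; hence there is none. The flat topology is compact, so finitely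
many elements outside \<open>M\<close> suffice to witness this, and their product lies in every member of \<open>E\<close> but
not in \<open>M\<close> (\<open>flat_closed_common_element\<close>). It lies in \<open>J \<subseteq> M\<close>, a contradiction
(\<open>s_unital_of_flat_closed\<close>).
\<close>

section \<open>Prime ideals and the flat topology\<close>

text \<open>
Krull's lemma: an ideal that is maximal among those containing \<open>I\<close> and avoiding a multiplicative
set \<open>S\<close> is prime. Every prime ideal needed later is obtained from it.
\<close>

lemma (in cring) exists_prime_avoiding:
  assumes "ideal I R" and S: "S \<subseteq> carrier R" "\<one> \<in> S" "\<And>s t. s \<in> S \<Longrightarrow> t \<in> S \<Longrightarrow> s \<otimes> t \<in> S"
    and "I \<inter> S = {}"
  shows "\<exists>P\<in>Spec R. I \<subseteq> P \<and> P \<inter> S = {}"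
proof -
  define \<A> where "\<A> = {J. ideal J R \<and> I \<subseteq> J \<and> J \<inter> S = {}}"
  have "\<exists>P\<in>\<A>. \<forall>J\<in>\<A>. P \<subseteq> J \<longrightarrow> J = P"
  proof (rule subset_Zorn_nonempty)
    show "\<A> \<noteq> {}" using assms unfolding \<A>_def by blast
    show "\<Union>\<C> \<in> \<A>" if "\<C> \<noteq> {}" and chain: "subset.chain \<A> \<C>" for \<C>
    proof -
      have "\<C> \<subseteq> \<A>" using chain by (simp add: subset_chain_def)
      moreover have "subset.chain {J. ideal J R} \<C>"
        using chain unfolding subset_chain_def \<A>_def by blast
      then have "ideal (\<Union>\<C>) R" using chain_Union_is_ideal[of \<C>] \<open>\<C> \<noteq> {}\<close> by simp
      ultimately show ?thesis using \<open>\<C> \<noteq> {}\<close> unfolding \<A>_def by blast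
    qed
  qed
  then obtain P where "P \<in> \<A>" and max: "\<And>J. J \<in> \<A> \<Longrightarrow> P \<subseteq> J \<Longrightarrow> J = P" by blast
  then have P: "ideal P R" "I \<subseteq> P" "P \<inter> S = {}" unfolding \<A>_def by auto
  interpret P: ideal P R by fact
  \<comment> \<open>By maximality, the ideal generated by P and an element outside P meets S.\<close>
  have meets: "\<exists>r\<in>carrier R. \<exists>p\<in>P. r \<otimes> x \<oplus> p \<in> S" if x: "x \<in> carrier R" "x \<notin> P" for x
  proof -
    let ?J = "PIdl x <+>\<^bsub>R\<^esub> P"
    have J: "ideal ?J R" by (intro add_ideals cgenideal_ideal x P)
    have "P \<subseteq> ?J"
    proof
      fix p assume p: "p \<in> P"
      have "\<zero> \<in> PIdl x" unfolding cgenideal_def using x by (auto intro!: exI[of _ \<zero>])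
      moreover have "p = \<zero> \<oplus> p" using p P.a_subset by auto
      ultimately show "p \<in> ?J" using p unfolding set_add_def' by blast
    qed
    moreover have "x \<in> ?J"
    proof -
      have "x = x \<oplus> \<zero>" using x by simp
      then show ?thesis using cgenideal_self[OF x(1)] P.zero_closed unfolding set_add_def' by blast
    qed
    ultimately have "?J \<notin> \<A>" using max x by blast
    then have "?J \<inter> S \<noteq> {}" using J P(2) \<open>P \<subseteq> ?J\<close> unfolding \<A>_def by blast
    then show ?thesis unfolding set_add_def' cgenideal_def by blast
  qed
  have "primeideal P R"
  proof (rule primeidealI)
    show "carrier R \<noteq> P" using S P by blast
    fix x y assume xy: "x \<in> carrier R" "y \<in> carrier R" "x \<otimes> y \<in> P"
    show "x \<in> P \<or> y \<in> P"
    proof (rule ccontr)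
      assume "\<not> (x \<in> P \<or> y \<in> P)"
      then obtain r p r' p' where *: "r \<in> carrier R" "p \<in> P" "r' \<in> carrier R" "p' \<in> P"
        "r \<otimes> x \<oplus> p \<in> S" "r' \<otimes> y \<oplus> p' \<in> S" using meets xy by metis
      note carr = * xy *(2,4)[THEN P.Icarr]
      have "(r \<otimes> x \<oplus> p) \<otimes> (r' \<otimes> y \<oplus> p') = (r \<otimes> r') \<otimes> (x \<otimes> y) \<oplus> (r \<otimes> x) \<otimes> p' \<oplus> (r' \<otimes> y \<oplus> p') \<otimes> p"
        using carr by algebra
      also have "\<dots> \<in> P"
        using carr by (intro P.a_closed P.I_l_closed[OF xy(3)] P.I_l_closed[OF *(4)] P.I_l_closed[OF *(2)]) simp_all
      finally show False using S(3) * P(3) by blast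
    qed
  qed (use P is_cring in auto)
  then show ?thesis using P unfolding Spec_def by blast
qed

lemma (in cring) Spec_subset_carrier: "P \<in> Spec R \<Longrightarrow> P \<subseteq> carrier R"
  unfolding Spec_def by (auto intro: ideal.Icarr[OF primeideal.axioms(1)])

text \<open>
By Alexander's subbase theorem only covers by sets \<open>V(f)\<close> matter. The elements \<open>s\<close> for which \<open>V(s)\<close>
has a finite subcover form a multiplicative set that contains each such \<open>f\<close>. If this set did not
contain \<open>0\<close>, a prime avoiding it would not be covered; and \<open>V(0)\<close> is the whole spectrum.
\<close>

lemma (in cring) compact_flat_topology: "compact_space (flat_topology R)"
proof -
  define \<B> where "\<B> = {{P \<in> Spec R. f \<in> P} | f. f \<in> carrier R}"
  define T where "T = topology (arbitrary union_of (finite intersection_of (\<lambda>x. x \<in> \<B>) relative_to Spec R))"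
  have top: "topspace (flat_topology R) = Spec R" by (rule topspace_flat_topology) (rule is_cring)
  have topT: "topspace T = Spec R" unfolding T_def by simp
  have "\<Union>\<B> = Spec R" using top unfolding flat_topology_def \<B>_def by simp
  have "compact_space T"
  proof (rule Alexander_subbase_alt)
    show "Spec R \<subseteq> \<Union>\<B>" using \<open>\<Union>\<B> = Spec R\<close> by simp
    fix C assume C: "C \<subseteq> \<B>" "Spec R \<subseteq> \<Union>C"
    define fin where "fin V \<longleftrightarrow> (\<exists>C'. finite C' \<and> C' \<subseteq> C \<and> V \<subseteq> \<Union>C')" for V
    have fin_Un: "fin W" if "fin U" "fin V" "W \<subseteq> U \<union> V" for U V W
    proof -
      obtain C1 C2 where "finite C1" "C1 \<subseteq> C" "U \<subseteq> \<Union>C1" "finite C2" "C2 \<subseteq> C" "V \<subseteq> \<Union>C2"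
        using \<open>fin U\<close> \<open>fin V\<close> unfolding fin_def by blast
      then show ?thesis unfolding fin_def using \<open>W \<subseteq> U \<union> V\<close> by (intro exI[of _ "C1 \<union> C2"]) auto
    qed
    define S where "S = {s \<in> carrier R. fin {P \<in> Spec R. s \<in> P}}"
    have "\<zero> \<in> S"
    proof (rule ccontr)
      assume "\<zero> \<notin> S"
      have "\<one> \<notin> P" if "P \<in> Spec R" for P
        using that primeideal.I_notcarr ideal.one_imp_carrier primeideal.axioms(1)
        unfolding Spec_def by blast
      then have "{P \<in> Spec R. \<one> \<in> P} = {}" by blast
      moreover have "fin {}" unfolding fin_def by (intro exI[of _ "{}"]) simp
      ultimately have one: "\<one> \<in> S" unfolding S_def by (simp only: mem_Collect_eq one_closed simp_thms)
      have mult: "s \<otimes> t \<in> S" if "s \<in> S" "t \<in> S" for s t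
      proof -
        have st: "s \<in> carrier R" "t \<in> carrier R" "fin {P \<in> Spec R. s \<in> P}" "fin {P \<in> Spec R. t \<in> P}"
          using that unfolding S_def by simp_all
        have "{P \<in> Spec R. s \<otimes> t \<in> P} \<subseteq> {P \<in> Spec R. s \<in> P} \<union> {P \<in> Spec R. t \<in> P}"
          using primeideal.I_prime[OF _ st(1,2)] unfolding Spec_def by auto
        from fin_Un[OF st(3,4) this] show ?thesis unfolding S_def using st(1,2) by simp
      qed
      have carr: "S \<subseteq> carrier R" unfolding S_def by blast
      have disj: "{\<zero>} \<inter> S = {}" using \<open>\<zero> \<notin> S\<close> by simp
      have "\<exists>P\<in>Spec R. {\<zero>} \<subseteq> P \<and> P \<inter> S = {}"
        by (intro exists_prime_avoiding zeroideal carr one mult disj)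
      then obtain P where P: "P \<in> Spec R" "P \<inter> S = {}" by blast
      then obtain V where V: "V \<in> C" "P \<in> V" using C(2) by (meson UnionE subsetD)
      have "V \<in> \<B>" by (rule subsetD[OF C(1) V(1)])
      then obtain f where "f \<in> carrier R" "V = {P \<in> Spec R. f \<in> P}" unfolding \<B>_def by auto
      with V have f: "f \<in> carrier R" "f \<in> P" "{P \<in> Spec R. f \<in> P} \<in> C" by simp_all
      have "fin {P \<in> Spec R. f \<in> P}"
        unfolding fin_def using f(3) by (intro exI[of _ "{{P \<in> Spec R. f \<in> P}}"]) simp
      then have "f \<in> S" unfolding S_def using f(1) by simp
      with P(2) f(2) show False by (meson disjoint_iff)
    qed
    moreover have "\<zero> \<in> P" if "P \<in> Spec R" for P
      using that additive_subgroup.zero_closed ideal.axioms(1) primeideal.axioms(1)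
      unfolding Spec_def by blast
    then have "{P \<in> Spec R. \<zero> \<in> P} = Spec R" by blast
    ultimately have "fin (Spec R)" unfolding S_def by simp
    then show "\<exists>C'. finite C' \<and> C' \<subseteq> C \<and> Spec R \<subseteq> \<Union>C'" unfolding fin_def .
  qed (simp add: T_def)
  \<comment> \<open>Compactness passes from T to any coarser topology on the same set.\<close>
  moreover have "openin T U" if "openin (flat_topology R) U" for U
  proof -
    have "openin T V" if "V \<in> \<B>" for V
    proof -
      have "(finite intersection_of (\<lambda>x. x \<in> \<B>) relative_to Spec R) (Spec R \<inter> V)"
        using that by (intro relative_to_inc finite_intersection_of_inc)
      moreover have "Spec R \<inter> V = V" using that unfolding \<B>_def by blast
      ultimately show ?thesis unfolding T_def openin_subbase
        by (simp add: arbitrary_union_of_inc)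
    qed
    then show ?thesis
      using that generate_topology_on_coarsest[OF istopology_openin]
      unfolding flat_topology_def openin_topology_generated_by_iff \<B>_def by blast
  qed
  ultimately show ?thesis unfolding compact_space_def compactin_def top topT by blast
qed

text \<open>
The generating opens \<open>V(f)\<close> are closed upwards under inclusion of primes, hence so are all opens.
\<close>

lemma flat_closed_generization:
  assumes "cring R" and E: "closedin (flat_topology R) E"
    and "P \<in> E" "Q \<in> Spec R" "Q \<subseteq> P"
  shows "Q \<in> E"
proof (rule ccontr)
  assume "Q \<notin> E"
  have top: "topspace (flat_topology R) = Spec R" by (rule topspace_flat_topology) fact
  have "openin (flat_topology R) (Spec R - E)"
    using E unfolding closedin_def top by blast
  then have "generate_topology_on {{P \<in> Spec R. f \<in> P} | f. f \<in> carrier R} (Spec R - E)"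
    unfolding flat_topology_def openin_topology_generated_by_iff .
  then have "Q \<in> Spec R - E \<longrightarrow> P \<in> Spec R - E"
  proof (induction rule: generate_topology_on.induct)
    case (Basis s)
    then show ?case
      using assms closedin_subset[OF E] top by auto
  qed auto
  with assms \<open>Q \<notin> E\<close> show False by blast
qed

text \<open>
The form in which compactness is used. Dually to prime avoidance, if the intersection of a flat
closed set \<open>E\<close> is contained in a prime \<open>M\<close>, then so is some member of \<open>E\<close>.
\<close>

lemma (in cring) flat_closed_common_element:
  assumes E: "closedin (flat_topology R) E" and "M \<in> Spec R"
    and below: "\<And>P. P \<in> E \<Longrightarrow> \<not> P \<subseteq> M"
  obtains c where "c \<in> carrier R" "c \<notin> M" "\<And>P. P \<in> E \<Longrightarrow> c \<in> P"
proof -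
  interpret M: primeideal M R using \<open>M \<in> Spec R\<close> unfolding Spec_def by simp
  define \<U> where "\<U> = {{P \<in> Spec R. f \<in> P} | f. f \<in> carrier R - M}"
  have "E \<subseteq> Spec R"
    using closedin_subset[OF E] topspace_flat_topology[OF is_cring] by simp
  have "\<exists>\<F>. finite \<F> \<and> \<F> \<subseteq> \<U> \<and> E \<subseteq> \<Union>\<F>"
  proof (rule compactinD)
    show "compactin (flat_topology R) E"
      by (rule closedin_compact_space[OF compact_flat_topology E])
    show "openin (flat_topology R) U" if "U \<in> \<U>" for U
      using that unfolding flat_topology_def \<U>_def
      by (intro topology_generated_by_Basis) blast
    show "E \<subseteq> \<Union>\<U>"
    proof
      fix P assume P: "P \<in> E"
      then obtain f where "f \<in> P" "f \<notin> M" using below by blast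
      moreover have "P \<subseteq> carrier R"
        using P \<open>E \<subseteq> Spec R\<close> Spec_subset_carrier by blast
      ultimately show "P \<in> \<Union>\<U>" using P \<open>E \<subseteq> Spec R\<close> unfolding \<U>_def by blast
    qed
  qed
  then obtain \<F> where \<F>: "finite \<F>" "\<F> \<subseteq> \<U>" "E \<subseteq> \<Union>\<F>" by blast
  \<comment> \<open>A finite union of sets V(f) lies in V of the product, and a product of elements outside M is outside M.\<close>
  from \<F>(1,2) have "\<exists>c\<in>carrier R - M. \<Union>\<F> \<subseteq> {P \<in> Spec R. c \<in> P}"
  proof (induction \<F>)
    case empty
    show ?case using M.one_imp_carrier M.I_notcarr by auto
  next
    case (insert V \<F>)
    then obtain c f where cf: "c \<in> carrier R - M" "\<Union>\<F> \<subseteq> {P \<in> Spec R. c \<in> P}"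
      "f \<in> carrier R - M" "V = {P \<in> Spec R. f \<in> P}" unfolding \<U>_def by blast
    have "c \<otimes> f \<in> carrier R - M" using cf M.I_prime by auto
    moreover have "c \<otimes> f \<in> P" if "P \<in> Spec R" "c \<in> P \<or> f \<in> P" for P
    proof -
      interpret P: primeideal P R using that unfolding Spec_def by simp
      show ?thesis using that(2) cf P.I_l_closed P.I_r_closed by blast
    qed
    ultimately show ?case using cf by blast
  qed
  then show thesis using that \<F>(3) by blast
qed


section \<open>Flatness of a quotient ring\<close>

text \<open>
This notion replaces flatness of the quotient. For a possibly non-unital ring it is known as s-unital:
every element has a unit of its own inside the ideal.
\<close>

definition s_unital :: "('a, 'm) ring_scheme \<Rightarrow> 'a set \<Rightarrow> bool"
  where "s_unital R I \<longleftrightarrow> (\<forall>a\<in>I. \<exists>b\<in>I. b \<otimes>\<^bsub>R\<^esub> a = a)"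

text \<open>
The module on which purity of \<open>I\<close> depends: \<open>R/I\<close> with scalars acting through the projection.
\<close>

abbreviation quotient_module :: "('a, 'm) ring_scheme \<Rightarrow> 'a set \<Rightarrow> ('a, 'a set) module"
  where "quotient_module R I \<equiv> restrict_scalars (R Quot I) (\<lambda>a. I +>\<^bsub>R\<^esub> a)"

lemma tensor_kernel_add_left:
  assumes "x \<in> carrier M" "x' \<in> carrier M" "y \<in> carrier N"
  shows "frag_of (x \<oplus>\<^bsub>M\<^esub> x', y) - frag_of (x, y) - frag_of (x', y) \<in> tensor_kernel R M N"
  unfolding tensor_kernel_def tensor_relators_def
  by (rule generate.incl, rule UnI1, rule UnI1, intro CollectI exI conjI, rule refl) (rule assms)+

lemma tensor_kernel_add_right:
  assumes "x \<in> carrier M" "y \<in> carrier N" "y' \<in> carrier N"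
  shows "frag_of (x, y \<oplus>\<^bsub>N\<^esub> y') - frag_of (x, y) - frag_of (x, y') \<in> tensor_kernel R M N"
  unfolding tensor_kernel_def tensor_relators_def
  by (rule generate.incl, rule UnI1, rule UnI2, intro CollectI exI conjI, rule refl) (rule assms)+

lemma tensor_kernel_smult:
  assumes "r \<in> carrier R" "x \<in> carrier M" "y \<in> carrier N"
  shows "frag_of (r \<odot>\<^bsub>M\<^esub> x, y) - frag_of (x, r \<odot>\<^bsub>N\<^esub> y) \<in> tensor_kernel R M N"
  unfolding tensor_kernel_def tensor_relators_def
  by (rule generate.incl, rule UnI2, intro CollectI exI conjI, rule refl) (rule assms)+

lemma free_coset_eq_iff:
  assumes K: "subgroup K (free_Abelian_group S)"
    and u: "u \<in> carrier (free_Abelian_group S)" and v: "v \<in> carrier (free_Abelian_group S)"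
  shows "K #>\<^bsub>free_Abelian_group S\<^esub> u = K #>\<^bsub>free_Abelian_group S\<^esub> v \<longleftrightarrow> u - v \<in> K"
proof -
  interpret F: group "free_Abelian_group S" by simp
  interpret K: subgroup K "free_Abelian_group S" by fact
  have "u \<in> K #>\<^bsub>free_Abelian_group S\<^esub> v \<longleftrightarrow> u - v \<in> K"
    unfolding r_coset_def by (auto intro: bexI[of _ "u - v"])
  then show ?thesis
    using F.repr_independence[OF _ v K] F.rcos_self[OF u K] by metis
qed

context
  fixes R :: "('a, 'm) ring_scheme" (structure) and I :: "'a set"
  assumes R: "cring R" and I: "ideal I R"
begin

interpretation cring R by (rule R)
interpretation ideal I R by (rule I)

lemma quotient_module_simps:
  "carrier (quotient_module R I) = a_rcosets I"
  "x \<in> carrier R \<Longrightarrow> y \<in> carrier R \<Longrightarrow>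
     (I +> x) \<oplus>\<^bsub>quotient_module R I\<^esub> (I +> y) = I +> (x \<oplus> y)"
  "r \<in> carrier R \<Longrightarrow> x \<in> carrier R \<Longrightarrow>
     r \<odot>\<^bsub>quotient_module R I\<^esub> (I +> x) = I +> (r \<otimes> x)"
  by (simp_all add: restrict_scalars_def FactRing_def a_rcos_sum rcoset_mult_add)

lemma zero_quotient_module: "\<zero>\<^bsub>quotient_module R I\<^esub> = I +> \<zero>"
  using a_rcos_zero[OF I zero_closed] by (simp add: restrict_scalars_def FactRing_def)

lemma coset_mem: "x \<in> carrier R \<Longrightarrow> I +> x \<in> a_rcosets I"
  by (rule a_rcosetsI[OF a_subset])

lemma coset_cases:
  assumes "C \<in> a_rcosets I"
  obtains x where "x \<in> carrier R" "C = I +> x"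
  using assms unfolding A_RCOSETS_def' by blast

lemma module_quotient_module: "module R (quotient_module R I)"
proof (rule moduleI)
  show "cring R" by (rule R)
  show "abelian_group (quotient_module R I)"
  proof (rule abelian_groupI)
    show "\<exists>D\<in>carrier (quotient_module R I). D \<oplus>\<^bsub>quotient_module R I\<^esub> C = \<zero>\<^bsub>quotient_module R I\<^esub>"
      if C: "C \<in> carrier (quotient_module R I)" for C
    proof -
      obtain x where x: "x \<in> carrier R" "C = I +> x"
        using C by (auto simp: quotient_module_simps elim: coset_cases)
      then show ?thesis
        by (intro bexI[of _ "I +> (\<ominus> x)"])
          (simp_all add: quotient_module_simps zero_quotient_module coset_mem l_neg)
    qed
  qed (auto simp: quotient_module_simps zero_quotient_module coset_mem a_ac elim!: coset_cases)
qed (auto simp: quotient_module_simps coset_mem l_distr r_distr m_assoc elim!: coset_cases)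

context
  fixes N :: "('a, 'c, 'l) module_scheme"
  assumes N: "module R N"
begin

interpretation N: module R N by (rule N)

abbreviation "quotient_kernel \<equiv> tensor_kernel R (quotient_module R I) N"

lemma subgroup_quotient_kernel: "subgroup quotient_kernel (free_Abelian_group ((a_rcosets I) \<times> carrier N))"
  using subgroup_tensor_kernel[OF module_quotient_module N] by (simp add: quotient_module_simps)

lemma quotient_kernel_add: "u \<in> quotient_kernel \<Longrightarrow> v \<in> quotient_kernel \<Longrightarrow> u + v \<in> quotient_kernel"
  using subgroup.m_closed[OF subgroup_quotient_kernel] by simp

lemma quotient_kernel_minus: assumes "u \<in> quotient_kernel" shows "- u \<in> quotient_kernel"
  using subgroup.m_inv_closed[OF subgroup_quotient_kernel assms] subgroup.mem_carrier[OF subgroup_quotient_kernel assms] by simp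

lemma quotient_kernel_diff: "u \<in> quotient_kernel \<Longrightarrow> v \<in> quotient_kernel \<Longrightarrow> u - v \<in> quotient_kernel"
  using quotient_kernel_add[OF _ quotient_kernel_minus, of u v] by simp

lemma
  assumes y: "y \<in> carrier N"
  shows tensor_add_left: "\<lbrakk>x \<in> carrier R; x' \<in> carrier R\<rbrakk> \<Longrightarrow>
      frag_of (I +> (x \<oplus> x'), y) - frag_of (I +> x, y) - frag_of (I +> x', y) \<in> quotient_kernel"
    and tensor_add_right: "\<lbrakk>x \<in> carrier R; y' \<in> carrier N\<rbrakk> \<Longrightarrow>
      frag_of (I +> x, y \<oplus>\<^bsub>N\<^esub> y') - frag_of (I +> x, y) - frag_of (I +> x, y') \<in> quotient_kernel"
    and tensor_smult: "r \<in> carrier R \<Longrightarrow> frag_of (I +> r, y) - frag_of (I +> \<one>, r \<odot>\<^bsub>N\<^esub> y) \<in> quotient_kernel"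
proof -
  have coset: "I +> x \<in> carrier (quotient_module R I)" if "x \<in> carrier R" for x
    using that by (simp add: quotient_module_simps coset_mem)
  show "frag_of (I +> (x \<oplus> x'), y) - frag_of (I +> x, y) - frag_of (I +> x', y) \<in> quotient_kernel"
    if "x \<in> carrier R" "x' \<in> carrier R"
    using tensor_kernel_add_left[OF coset coset y] that by (simp add: quotient_module_simps(2))
  show "frag_of (I +> x, y \<oplus>\<^bsub>N\<^esub> y') - frag_of (I +> x, y) - frag_of (I +> x, y') \<in> quotient_kernel"
    if "x \<in> carrier R" "y' \<in> carrier N"
    using that y by (intro tensor_kernel_add_right coset)
  show "frag_of (I +> r, y) - frag_of (I +> \<one>, r \<odot>\<^bsub>N\<^esub> y) \<in> quotient_kernel" if r: "r \<in> carrier R"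
    using tensor_kernel_smult[OF r coset[OF one_closed] y] r by (simp add: quotient_module_simps(3))
qed

lemma tensor_diff_right:
  assumes y: "y \<in> carrier N" "y' \<in> carrier N"
  shows "frag_of (I +> \<one>, y \<ominus>\<^bsub>N\<^esub> y') - (frag_of (I +> \<one>, y) - frag_of (I +> \<one>, y')) \<in> quotient_kernel"
proof -
  have "(y \<ominus>\<^bsub>N\<^esub> y') \<oplus>\<^bsub>N\<^esub> y' = y"
    using y by (simp add: a_minus_def N.M.a_assoc N.M.l_neg)
  then have "frag_of (I +> \<one>, y) - frag_of (I +> \<one>, y \<ominus>\<^bsub>N\<^esub> y') - frag_of (I +> \<one>, y') \<in> quotient_kernel"
    using tensor_add_right[of "y \<ominus>\<^bsub>N\<^esub> y'" \<one> y'] y by simp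
  from quotient_kernel_minus[OF this] show ?thesis by (simp add: algebra_simps)
qed

text \<open>
\<open>1 \<otimes> i y = i \<otimes> y = 0\<close>, as \<open>i\<close> is zero in \<open>R/I\<close>.
\<close>

lemma tensor_ideal_smult:
  assumes "i \<in> I" "y \<in> carrier N"
  shows "frag_of (I +> \<one>, i \<odot>\<^bsub>N\<^esub> y) \<in> quotient_kernel"
proof -
  have i: "i \<in> carrier R" using assms Icarr by blast
  have "I +> i = I +> \<zero>"
    using assms a_rcos_zero[OF I] a_subset by simp
  moreover have "frag_of (I +> \<zero>, y) \<in> quotient_kernel"
    using quotient_kernel_minus[OF tensor_add_left[OF assms(2), of \<zero> \<zero>]] by simp
  ultimately have "frag_of (I +> i, y) \<in> quotient_kernel" by simp
  from quotient_kernel_diff[OF this tensor_smult[OF assms(2) i]] show ?thesis by simp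
qed

text \<open>
\<open>R/I\<close> is cyclic, so every element of the tensor product is an elementary tensor \<open>1 \<otimes> y\<close>.
\<close>

lemma tensor_pure:
  assumes "t \<in> carrier (free_Abelian_group ((a_rcosets I) \<times> carrier N))"
  shows "\<exists>y\<in>carrier N. t - frag_of (I +> \<one>, y) \<in> quotient_kernel"
proof -
  have "Poly_Mapping.keys t \<subseteq> (a_rcosets I) \<times> carrier N" using assms by simp
  then show ?thesis
  proof (induction t rule: frag_induction)
    case zero
    show ?case
      using quotient_kernel_minus[OF tensor_ideal_smult[OF zero_closed N.M.zero_closed]] by auto
  next
    case (one p)
    then obtain x y where xy: "p = (I +> x, y)" "x \<in> carrier R" "y \<in> carrier N"
      by (auto elim: coset_cases)
    then show ?case using tensor_smult[OF xy(3,2)] by auto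
  next
    case (diff u v)
    then obtain y z where yz: "y \<in> carrier N" "z \<in> carrier N"
      and "u - frag_of (I +> \<one>, y) \<in> quotient_kernel" "v - frag_of (I +> \<one>, z) \<in> quotient_kernel" by blast
    from quotient_kernel_diff[OF quotient_kernel_diff[OF this(3,4)] tensor_diff_right[OF this(1,2)]]
    have "u - v - frag_of (I +> \<one>, y \<ominus>\<^bsub>N\<^esub> z) \<in> quotient_kernel" by (simp add: algebra_simps)
    then show ?case using yz by blast
  qed
qed

text \<open>
The only lemma that bounds the tensor kernel from above. Since \<open>L\<close> contains \<open>I N\<close>, sending
\<open>(x + I, n)\<close> to \<open>x n + L\<close> is a well-defined balanced map into the group \<open>N/L\<close>, so it vanishes on
the tensor kernel, and it sends \<open>(1, y)\<close> to \<open>y + L\<close>. Leaving \<open>L\<close> free avoids a description of \<open>I N\<close>: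
it is chosen below to suit each use.
\<close>

lemma tensor_kernel_imp_mem:
  assumes L: "additive_subgroup L N" and IL: "\<And>i n. i \<in> I \<Longrightarrow> n \<in> carrier N \<Longrightarrow> i \<odot>\<^bsub>N\<^esub> n \<in> L"
    and y: "y \<in> carrier N" and mem: "frag_of (I +> \<one>, y) \<in> quotient_kernel"
  shows "y \<in> L"
proof -
  interpret L: abelian_subgroup L N by (rule abelian_subgroupI3[OF L N.M.abelian_group_axioms])
  interpret Q: comm_group "N A_Mod L" by (rule L.a_factorgroup_is_comm_group)
  let ?F = "free_Abelian_group ((a_rcosets I) \<times> carrier N)"
  \<comment> \<open>The value on a coset is computed from a chosen representative; the next step shows that any representative gives the same.\<close>
  define f where "f = (\<lambda>(C, n). L +>\<^bsub>N\<^esub> ((SOME x. x \<in> C) \<odot>\<^bsub>N\<^esub> n))"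
  have f: "f (I +> x, n) = L +>\<^bsub>N\<^esub> (x \<odot>\<^bsub>N\<^esub> n)" if "x \<in> carrier R" "n \<in> carrier N" for x n
  proof -
    define x' where "x' = (SOME x'. x' \<in> I +> x)"
    have x': "x' \<in> I +> x" unfolding x'_def using a_rcos_self[OF that(1)] by (rule someI)
    then have "x' \<in> carrier R" using a_elemrcos_carrier[OF that(1)] by blast
    have "x' \<oplus> \<ominus> x \<in> I" by (rule a_rcos_module_imp[OF that(1) x'])
    then have "(x' \<oplus> \<ominus> x) \<odot>\<^bsub>N\<^esub> n \<in> L" using IL that by blast
    moreover have "(x' \<oplus> \<ominus> x) \<odot>\<^bsub>N\<^esub> n = x' \<odot>\<^bsub>N\<^esub> n \<oplus>\<^bsub>N\<^esub> \<ominus>\<^bsub>N\<^esub> (x \<odot>\<^bsub>N\<^esub> n)"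
      using that \<open>x' \<in> carrier R\<close> by (simp add: N.smult_l_distr N.smult_l_minus)
    ultimately have "x' \<odot>\<^bsub>N\<^esub> n \<in> L +>\<^bsub>N\<^esub> (x \<odot>\<^bsub>N\<^esub> n)"
      using L.a_rcos_module_rev that \<open>x' \<in> carrier R\<close> by simp
    then have "L +>\<^bsub>N\<^esub> (x \<odot>\<^bsub>N\<^esub> n) = L +>\<^bsub>N\<^esub> (x' \<odot>\<^bsub>N\<^esub> n)"
      using L.a_repr_independence' that by simp
    moreover have "f (I +> x, n) = L +>\<^bsub>N\<^esub> (x' \<odot>\<^bsub>N\<^esub> n)" by (simp add: f_def x'_def)
    ultimately show ?thesis by simp
  qed
  have carr: "L +>\<^bsub>N\<^esub> n \<in> carrier (N A_Mod L)" if "n \<in> carrier N" for n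
    unfolding A_FactGroup_def' using N.M.a_rcosetsI[OF L.a_subset that] by simp
  have fim: "f ` ((a_rcosets I) \<times> carrier N) \<subseteq> carrier (N A_Mod L)"
  proof (rule image_subsetI)
    fix p assume "p \<in> (a_rcosets I) \<times> carrier N"
    then obtain C n where p: "p = (C, n)" "C \<in> a_rcosets I" "n \<in> carrier N" by blast
    then obtain x where "x \<in> carrier R" "C = I +> x" using coset_cases by metis
    with p show "f p \<in> carrier (N A_Mod L)" using f carr N.smult_closed by simp
  qed
  then obtain h where h: "h \<in> hom ?F (N A_Mod L)"
    and hf: "\<And>p. p \<in> (a_rcosets I) \<times> carrier N \<Longrightarrow> h (frag_of p) = f p"
    using Q.free_Abelian_group_universal[OF fim] by blast
  interpret h: group_hom ?F "N A_Mod L" h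
    using h by (simp add: group_hom_def group_hom_axioms_def)
  note coset = coset_mem
  have hx: "h (frag_of (I +> x, n)) = L +>\<^bsub>N\<^esub> (x \<odot>\<^bsub>N\<^esub> n)" if "x \<in> carrier R" "n \<in> carrier N" for x n
    using that by (simp add: hf f coset)
  have ker: "u - v \<in> kernel ?F (N A_Mod L) h" if "u \<in> carrier ?F" "v \<in> carrier ?F" "h u = h v" for u v
  proof -
    have "u - v = u \<otimes>\<^bsub>?F\<^esub> inv\<^bsub>?F\<^esub> v" using that(2) by simp
    moreover have "h (u \<otimes>\<^bsub>?F\<^esub> inv\<^bsub>?F\<^esub> v) = \<one>\<^bsub>N A_Mod L\<^esub>"
      using that by (simp only: h.hom_mult h.hom_inv h.G.inv_closed Q.r_inv h.hom_closed)
    ultimately show ?thesis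
      using that unfolding kernel_def by (metis (mono_tags, lifting) h.G.inv_closed h.G.m_closed mem_Collect_eq)
  qed
  have fc: "frag_of (I +> x, n) \<in> carrier ?F" if "x \<in> carrier R" "n \<in> carrier N" for x n
    using that coset by simp
  have hadd: "h (u + v) = h u <+>\<^bsub>N\<^esub> h v" "u + v \<in> carrier ?F" if "u \<in> carrier ?F" "v \<in> carrier ?F" for u v
    using h.hom_mult[OF that] h.G.m_closed[OF that] by simp_all
  have sum: "(L +>\<^bsub>N\<^esub> m) <+>\<^bsub>N\<^esub> (L +>\<^bsub>N\<^esub> n) = L +>\<^bsub>N\<^esub> (m \<oplus>\<^bsub>N\<^esub> n)"
    if "m \<in> carrier N" "n \<in> carrier N" for m n
    using L.a_rcos_sum that by simp
  have "tensor_relators R (quotient_module R I) N \<subseteq> kernel ?F (N A_Mod L) h"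
  proof
    fix t assume "t \<in> tensor_relators R (quotient_module R I) N"
    then consider
      (left) x x' n where "t = frag_of (I +> (x \<oplus> x'), n) - frag_of (I +> x, n) - frag_of (I +> x', n)"
        "x \<in> carrier R" "x' \<in> carrier R" "n \<in> carrier N"
      | (right) x n n' where "t = frag_of (I +> x, n \<oplus>\<^bsub>N\<^esub> n') - frag_of (I +> x, n) - frag_of (I +> x, n')"
        "x \<in> carrier R" "n \<in> carrier N" "n' \<in> carrier N"
      | (smult) r x n where "t = frag_of (I +> (r \<otimes> x), n) - frag_of (I +> x, r \<odot>\<^bsub>N\<^esub> n)"
        "r \<in> carrier R" "x \<in> carrier R" "n \<in> carrier N"
      unfolding tensor_relators_def
      by (auto simp: quotient_module_simps elim!: coset_cases)
    then show "t \<in> kernel ?F (N A_Mod L) h"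
    proof cases
      case left
      have "frag_of (I +> (x \<oplus> x'), n) - (frag_of (I +> x, n) + frag_of (I +> x', n)) \<in> kernel ?F (N A_Mod L) h"
        using left(2-) by (intro ker) (simp_all only: fc hadd hx sum add.m_closed N.smult_closed N.smult_l_distr)
      then show ?thesis by (simp only: left(1) diff_diff_eq)
    next
      case right
      have "frag_of (I +> x, n \<oplus>\<^bsub>N\<^esub> n') - (frag_of (I +> x, n) + frag_of (I +> x, n')) \<in> kernel ?F (N A_Mod L) h"
        using right(2-) by (intro ker) (simp_all only: fc hadd hx sum N.M.a_closed N.smult_closed N.smult_r_distr)
      then show ?thesis by (simp only: right(1) diff_diff_eq)
    next
      case smult
      have "r \<otimes> x = x \<otimes> r" using smult by (simp add: m_comm)
      then show ?thesis unfolding smult(1) using smult(2-)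
        by (intro ker) (simp_all only: fc hx m_closed N.smult_closed N.smult_assoc1)
    qed
  qed
  then have "quotient_kernel \<subseteq> kernel ?F (N A_Mod L) h"
    unfolding tensor_kernel_def using h.G.generate_subgroup_incl[OF _ h.subgroup_kernel]
    by (simp add: quotient_module_simps)
  then have "h (frag_of (I +> \<one>, y)) = \<one>\<^bsub>N A_Mod L\<^esub>" using mem unfolding kernel_def by blast
  then have "L +>\<^bsub>N\<^esub> y = L" using y by (simp add: hx A_FactGroup_def')
  then show "y \<in> L" using L.a_rcos_self[OF y] by simp
qed

end

end

text \<open>
If \<open>1 \<otimes> g d = 0\<close> in \<open>R/I \<otimes> N\<close>, then \<open>g d\<close> is fixed by some \<open>b \<in> I\<close>. As \<open>g\<close> is linear and injective,
\<open>b\<close> also fixes \<open>d\<close>, and \<open>1 \<otimes> d = 1 \<otimes> b d = 0\<close> in \<open>R/I \<otimes> N'\<close>. Differences \<open>d = y - z\<close> give injectivity.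
\<close>

lemma flat_quotient_of_s_unital:
  fixes R :: "('a, 'm) ring_scheme" (structure)
  assumes "cring R" and I: "ideal I R" and "s_unital R I"
  shows "flat_module TYPE('u) R (quotient_module R I)"
proof -
  interpret cring R by fact
  interpret I: ideal I R by fact
  have inj: "inj_on (tensor_map R (quotient_module R I) N g) (carrier (tensor_product R (quotient_module R I) N'))"
    if N': "module R N'" and N: "module R N" and g: "g \<in> module_hom R N' N" "inj_on g (carrier N')"
    for N' N :: "('a, 'u) module" and g
  proof (rule inj_onI)
    interpret N': module R N' by fact
    interpret N: module R N by fact
    let ?M = "quotient_module R I"
    let ?F' = "free_Abelian_group ((a_rcosets I) \<times> carrier N')"
    let ?F = "free_Abelian_group ((a_rcosets I) \<times> carrier N)"
    let ?K' = "tensor_kernel R ?M N'" and ?K = "tensor_kernel R ?M N"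
    note M = module_quotient_module[OF assms(1) I]
    have gc: "g y \<in> carrier N" if "y \<in> carrier N'" for y using g(1) that unfolding module_hom_def by blast
    have coset: "I +> \<one> \<in> a_rcosets I" by (rule coset_mem[OF assms(1) I one_closed])
    have rep: "\<exists>y\<in>carrier N'. C = ?K' #>\<^bsub>?F'\<^esub> frag_of (I +> \<one>, y)"
      if C: "C \<in> carrier (tensor_product R ?M N')" for C
    proof -
      obtain t where t: "t \<in> carrier ?F'" "C = ?K' #>\<^bsub>?F'\<^esub> t"
        using C unfolding tensor_product_def FactGroup_def RCOSETS_def
        by (auto simp: quotient_module_simps[OF assms(1) I])
      obtain y where "y \<in> carrier N'" "t - frag_of (I +> \<one>, y) \<in> ?K'"
        using tensor_pure[OF assms(1) I N' t(1)] by blast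
      then show ?thesis
        using free_coset_eq_iff[OF subgroup_quotient_kernel[OF assms(1) I N'] t(1), of "frag_of (I +> \<one>, y)"] t coset by auto
    qed
    have map: "tensor_map R ?M N g (?K' #>\<^bsub>?F'\<^esub> frag_of (I +> \<one>, y)) = ?K #>\<^bsub>?F\<^esub> frag_of (I +> \<one>, g y)"
      if "y \<in> carrier N'" for y
      using tensor_map_coset[OF M N' N g(1), of "frag_of (I +> \<one>, y)"] that coset
      by (simp add: quotient_module_simps[OF assms(1) I] free_map_def)
    \<comment> \<open>The elements fixed by some member of I form a subgroup, which contains I N because I is s-unital.\<close>
    define L where "L = {n \<in> carrier N. \<exists>b\<in>I. b \<odot>\<^bsub>N\<^esub> n = n}"
    have L: "additive_subgroup L N"
    proof (intro additive_subgroupI subgroup.intro)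
      fix m n assume "m \<in> L" "n \<in> L"
      then obtain b c where b: "b \<in> I" "b \<odot>\<^bsub>N\<^esub> m = m" and c: "c \<in> I" "c \<odot>\<^bsub>N\<^esub> n = n"
        and mn: "m \<in> carrier N" "n \<in> carrier N" unfolding L_def by blast
      have bc: "b \<in> carrier R" "c \<in> carrier R" using b c I.Icarr by auto
      \<comment> \<open>Since 1 - (b + c - b c) = (1 - b) (1 - c), this element fixes whatever b or c fixes.\<close>
      have absorb: "(b \<oplus> c \<ominus> b \<otimes> c) \<odot>\<^bsub>N\<^esub> k = k"
        if k: "k \<in> carrier N" "b \<odot>\<^bsub>N\<^esub> k = k \<or> c \<odot>\<^bsub>N\<^esub> k = k" for k
      proof -
        have "(b \<otimes> c) \<odot>\<^bsub>N\<^esub> k = b \<odot>\<^bsub>N\<^esub> (c \<odot>\<^bsub>N\<^esub> k)" using bc k by (simp add: N.smult_assoc1)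
        moreover have "(b \<otimes> c) \<odot>\<^bsub>N\<^esub> k = c \<odot>\<^bsub>N\<^esub> (b \<odot>\<^bsub>N\<^esub> k)"
          using bc k by (simp add: N.smult_assoc1[symmetric] m_comm)
        moreover have "(b \<oplus> c \<ominus> b \<otimes> c) \<odot>\<^bsub>N\<^esub> k =
            b \<odot>\<^bsub>N\<^esub> k \<oplus>\<^bsub>N\<^esub> c \<odot>\<^bsub>N\<^esub> k \<oplus>\<^bsub>N\<^esub> \<ominus>\<^bsub>N\<^esub> ((b \<otimes> c) \<odot>\<^bsub>N\<^esub> k)"
          using bc k(1) by (simp add: a_minus_def N.smult_l_distr N.smult_l_minus)
        moreover have "u \<oplus>\<^bsub>N\<^esub> v \<oplus>\<^bsub>N\<^esub> \<ominus>\<^bsub>N\<^esub> v = u" "v \<oplus>\<^bsub>N\<^esub> u \<oplus>\<^bsub>N\<^esub> \<ominus>\<^bsub>N\<^esub> v = u"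
          if "u \<in> carrier N" "v \<in> carrier N" for u v
          using that by (simp_all add: N.M.a_assoc N.M.r_neg N.M.a_comm[of v u])
        ultimately show ?thesis using k bc by (metis N.smult_closed)
      qed
      have "b \<oplus> c \<ominus> b \<otimes> c \<in> I"
        using b(1) c(1) bc unfolding a_minus_def by (intro I.a_closed I.a_inv_closed I.I_l_closed)
      then show "m \<otimes>\<^bsub>add_monoid N\<^esub> n \<in> L"
        using absorb[of m] absorb[of n] b c mn bc unfolding L_def
        by (auto intro!: bexI[of _ "b \<oplus> c \<ominus> b \<otimes> c"] simp: N.smult_r_distr)
    next
      fix m assume "m \<in> L"
      then obtain b where b: "b \<in> I" "b \<odot>\<^bsub>N\<^esub> m = m" "m \<in> carrier N" unfolding L_def by blast
      then have "b \<odot>\<^bsub>N\<^esub> (\<ominus>\<^bsub>N\<^esub> m) = \<ominus>\<^bsub>N\<^esub> m" using I.Icarr by (simp add: N.smult_r_minus)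
      then show "inv\<^bsub>add_monoid N\<^esub> m \<in> L" using b unfolding L_def a_inv_def[symmetric] by auto
    next
      show "\<one>\<^bsub>add_monoid N\<^esub> \<in> L" unfolding L_def by (auto intro: I.zero_closed)
    qed (auto simp: L_def)
    have IL: "i \<odot>\<^bsub>N\<^esub> n \<in> L" if "i \<in> I" "n \<in> carrier N" for i n
    proof -
      obtain b where "b \<in> I" "b \<otimes> i = i" using assms(3) \<open>i \<in> I\<close> unfolding s_unital_def by blast
      then have "b \<odot>\<^bsub>N\<^esub> (i \<odot>\<^bsub>N\<^esub> n) = i \<odot>\<^bsub>N\<^esub> n"
        using that I.Icarr by (simp add: N.smult_assoc1[symmetric])
      then show ?thesis unfolding L_def using \<open>b \<in> I\<close> that I.Icarr by auto
    qed
    fix C D assume "C \<in> carrier (tensor_product R ?M N')" "D \<in> carrier (tensor_product R ?M N')"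
      and eq: "tensor_map R ?M N g C = tensor_map R ?M N g D"
    then obtain y z where y: "y \<in> carrier N'" "C = ?K' #>\<^bsub>?F'\<^esub> frag_of (I +> \<one>, y)"
      and z: "z \<in> carrier N'" "D = ?K' #>\<^bsub>?F'\<^esub> frag_of (I +> \<one>, z)" using rep by blast
    have "?K #>\<^bsub>?F\<^esub> frag_of (I +> \<one>, g y) = ?K #>\<^bsub>?F\<^esub> frag_of (I +> \<one>, g z)"
      using eq map y z by simp
    then have "frag_of (I +> \<one>, g y) - frag_of (I +> \<one>, g z) \<in> ?K"
      using free_coset_eq_iff[OF subgroup_quotient_kernel[OF assms(1) I N], of "frag_of (I +> \<one>, g y)" "frag_of (I +> \<one>, g z)"]
        gc y z coset by simp
    from quotient_kernel_add[OF assms(1) I N tensor_diff_right[OF assms(1) I N gc[OF y(1)] gc[OF z(1)]] this]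
    have "frag_of (I +> \<one>, g y \<ominus>\<^bsub>N\<^esub> g z) \<in> ?K" by simp
    moreover have "g (y \<ominus>\<^bsub>N'\<^esub> z) = g y \<ominus>\<^bsub>N\<^esub> g z"
    proof -
      let ?d = "y \<ominus>\<^bsub>N'\<^esub> z"
      have "g ?d \<oplus>\<^bsub>N\<^esub> g z = g (?d \<oplus>\<^bsub>N'\<^esub> z)"
        using g(1) y z unfolding module_hom_def by simp
      also have "?d \<oplus>\<^bsub>N'\<^esub> z = y"
        using y z by (simp add: a_minus_def N'.M.a_assoc N'.M.l_neg)
      finally show ?thesis
        using gc y z by (metis N'.M.minus_closed N.M.add.inv_solve_right a_minus_def a_inv_def N.M.add.inv_closed)
    qed
    ultimately have "frag_of (I +> \<one>, g (y \<ominus>\<^bsub>N'\<^esub> z)) \<in> ?K" by simp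
    then have "g (y \<ominus>\<^bsub>N'\<^esub> z) \<in> L"
      using tensor_kernel_imp_mem[OF assms(1) I N L IL] gc y z by simp
    then obtain b where b: "b \<in> I" "b \<odot>\<^bsub>N\<^esub> g (y \<ominus>\<^bsub>N'\<^esub> z) = g (y \<ominus>\<^bsub>N'\<^esub> z)" unfolding L_def by blast
    then have "g (b \<odot>\<^bsub>N'\<^esub> (y \<ominus>\<^bsub>N'\<^esub> z)) = g (y \<ominus>\<^bsub>N'\<^esub> z)"
      using g(1) y z I.Icarr unfolding module_hom_def by simp
    then have "b \<odot>\<^bsub>N'\<^esub> (y \<ominus>\<^bsub>N'\<^esub> z) = y \<ominus>\<^bsub>N'\<^esub> z"
      using g(2) y z I.Icarr[OF b(1)] by (auto dest: inj_onD)
    then have "frag_of (I +> \<one>, y \<ominus>\<^bsub>N'\<^esub> z) \<in> ?K'"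
      using tensor_ideal_smult[OF assms(1) I N' b(1), of "y \<ominus>\<^bsub>N'\<^esub> z"] y z by simp
    from quotient_kernel_diff[OF assms(1) I N' this tensor_diff_right[OF assms(1) I N' y(1) z(1)]]
    have "frag_of (I +> \<one>, y) - frag_of (I +> \<one>, z) \<in> ?K'" by simp
    then show "C = D"
      using free_coset_eq_iff[OF subgroup_quotient_kernel[OF assms(1) I N'], of "frag_of (I +> \<one>, y)" "frag_of (I +> \<one>, z)"]
        y z coset by simp
  qed
  then show ?thesis
    unfolding flat_module_def using module_quotient_module[OF assms(1) I] by blast
qed

text \<open>
Flatness is tested on modules carried by the type \<open>'u\<close>, so ideals of \<open>R\<close> must be transported along
an injection \<open>e\<close> into that type before they can serve as test modules.
\<close>

definition ideal_copy :: "('a, 'm) ring_scheme \<Rightarrow> ('a \<Rightarrow> 'u) \<Rightarrow> 'a set \<Rightarrow> ('a, 'u) module"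
  where "ideal_copy R e J = (let d = inv_into (carrier R) e in
    \<lparr>carrier = e ` J, monoid.mult = (\<lambda>u v. e (d u \<otimes>\<^bsub>R\<^esub> d v)), monoid.one = e \<one>\<^bsub>R\<^esub>,
     ring.zero = e \<zero>\<^bsub>R\<^esub>, ring.add = (\<lambda>u v. e (d u \<oplus>\<^bsub>R\<^esub> d v)), smult = (\<lambda>r u. e (r \<otimes>\<^bsub>R\<^esub> d u))\<rparr>)"

lemma ideal_copy_simps:
  assumes e: "inj_on e (carrier R)"
  shows "carrier (ideal_copy R e J) = e ` J" "\<zero>\<^bsub>ideal_copy R e J\<^esub> = e \<zero>\<^bsub>R\<^esub>"
    "\<lbrakk>x \<in> carrier R; y \<in> carrier R\<rbrakk> \<Longrightarrow> e x \<oplus>\<^bsub>ideal_copy R e J\<^esub> e y = e (x \<oplus>\<^bsub>R\<^esub> y)"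
    "x \<in> carrier R \<Longrightarrow> r \<odot>\<^bsub>ideal_copy R e J\<^esub> e x = e (r \<otimes>\<^bsub>R\<^esub> x)"
  using e by (simp_all add: ideal_copy_def Let_def)

lemma module_ideal_copy:
  assumes "cring R" and J: "ideal J R" and e: "inj_on e (carrier R)"
  shows "module R (ideal_copy R e J)"
proof -
  interpret cring R by fact
  interpret J: ideal J R by fact
  note simps = ideal_copy_simps[OF e]
  show ?thesis
  proof (rule moduleI)
    show "abelian_group (ideal_copy R e J)"
    proof (rule abelian_groupI)
      show "\<exists>v\<in>carrier (ideal_copy R e J). v \<oplus>\<^bsub>ideal_copy R e J\<^esub> u = \<zero>\<^bsub>ideal_copy R e J\<^esub>"
        if u: "u \<in> carrier (ideal_copy R e J)" for u
      proof -
        obtain x where x: "x \<in> J" "u = e x" using u by (auto simp: simps)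
        then show ?thesis
          by (intro bexI[of _ "e (\<ominus>\<^bsub>R\<^esub> x)"]) (simp_all add: simps l_neg)
      qed
    qed (auto simp: simps a_ac)
  qed (use J.I_l_closed in \<open>auto simp: simps is_cring l_distr r_distr m_assoc\<close>)
qed

text \<open>
Test flatness on the inclusion of the principal ideal \<open>R a\<close> into \<open>R\<close>. In \<open>R/I \<otimes> R\<close> the equation
\<open>1 \<otimes> a = a \<otimes> 1 = 0\<close> holds, so by flatness \<open>1 \<otimes> a = 0\<close> already in \<open>R/I \<otimes> R a\<close>, and therefore \<open>a \<in> I a\<close>.
\<close>

lemma s_unital_of_flat_quotient:
  fixes R :: "('a, 'm) ring_scheme" (structure)
  assumes R: "cring R" and I: "ideal I R" and universe: "carrier R \<lesssim> (UNIV :: 'u set)"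
    and flat: "flat_module TYPE('u) R (quotient_module R I)"
  shows "s_unital R I"
  unfolding s_unital_def
proof
  interpret cring R by fact
  interpret I: ideal I R by fact
  obtain e :: "'a \<Rightarrow> 'u" where e: "inj_on e (carrier R)" using universe unfolding lepoll_def by blast
  note simps = ideal_copy_simps[OF e]
  fix a assume "a \<in> I"
  then have ac: "a \<in> carrier R" by (rule I.Icarr)
  have J: "ideal (PIdl a) R" by (rule cgenideal_ideal[OF ac])
  have JR: "PIdl a \<subseteq> carrier R" using ideal.Icarr[OF J] by blast
  let ?N = "ideal_copy R e (carrier R)" and ?N' = "ideal_copy R e (PIdl a)"
  let ?M = "quotient_module R I"
  have N: "module R ?N" by (rule module_ideal_copy[OF R oneideal e])
  have N': "module R ?N'" by (rule module_ideal_copy[OF R J e])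
  interpret N': module R ?N' by (rule N')
  have g: "id \<in> module_hom R ?N' ?N"
    unfolding module_hom_def using JR by (auto simp: ideal_copy_def Let_def)
  have M: "module R ?M" by (rule module_quotient_module[OF R I])
  have coset: "I +> \<one> \<in> a_rcosets I" by (rule coset_mem[OF R I one_closed])
  let ?F' = "free_Abelian_group ((a_rcosets I) \<times> carrier ?N')"
  let ?F = "free_Abelian_group ((a_rcosets I) \<times> carrier ?N)"
  let ?K' = "tensor_kernel R ?M ?N'" and ?K = "tensor_kernel R ?M ?N"
  let ?t = "frag_of (I +> \<one>, e a)"
  have ea: "e a \<in> carrier ?N'" using cgenideal_self[OF ac] by (simp add: simps)
  then have t: "?t \<in> carrier ?F'" using coset by simp
  have ea': "e a \<in> carrier ?N" using ac by (simp add: simps)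
  have inj: "inj_on (tensor_map R ?M ?N id) (carrier (tensor_product R ?M ?N'))"
    using flat[unfolded flat_module_def, THEN conjunct2, rule_format, of ?N' ?N id] N N' g by simp
  have map: "tensor_map R ?M ?N id (?K' #>\<^bsub>?F'\<^esub> s) = ?K #>\<^bsub>?F\<^esub> free_map id s"
    if "s \<in> carrier ?F'" for s
    using tensor_map_coset[OF M N' N g, of s] that by (simp only: quotient_module_simps[OF R I])
  have z: "0 \<in> carrier ?F'" by simp
  have zF: "0 \<in> carrier ?F" by simp
  have tF: "?t \<in> carrier ?F" using coset ea' by simp
  have "?t \<in> ?K"
    using tensor_ideal_smult[OF R I N \<open>a \<in> I\<close>, of "e \<one>"] ac by (simp add: simps)
  then have "?K #>\<^bsub>?F\<^esub> ?t = ?K #>\<^bsub>?F\<^esub> 0"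
    using free_coset_eq_iff[OF subgroup_quotient_kernel[OF R I N] tF zF] by simp
  then have "tensor_map R ?M ?N id (?K' #>\<^bsub>?F'\<^esub> ?t) = tensor_map R ?M ?N id (?K' #>\<^bsub>?F'\<^esub> 0)"
    unfolding map[OF t] map[OF z] by (simp add: free_map_def)
  moreover have "?K' #>\<^bsub>?F'\<^esub> s \<in> carrier (tensor_product R ?M ?N')" if "s \<in> carrier ?F'" for s
    using that unfolding tensor_product_def FactGroup_def RCOSETS_def
    by (auto simp: quotient_module_simps[OF R I])
  ultimately have "?K' #>\<^bsub>?F'\<^esub> ?t = ?K' #>\<^bsub>?F'\<^esub> 0" using inj t z by (meson inj_onD)
  then have tK: "?t \<in> ?K'"
    using free_coset_eq_iff[OF subgroup_quotient_kernel[OF R I N'] t z] by simp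
  define L where "L = e ` {i \<otimes> a | i. i \<in> I}"
  have L: "additive_subgroup L ?N'"
  proof (intro additive_subgroupI subgroup.intro)
    show "L \<subseteq> carrier (add_monoid ?N')"
      unfolding L_def using I.Icarr by (auto simp: simps cgenideal_def intro!: imageI)
    show "u \<otimes>\<^bsub>add_monoid ?N'\<^esub> v \<in> L" if uv: "u \<in> L" "v \<in> L" for u v
    proof -
      obtain i j where ij: "i \<in> I" "j \<in> I" "u = e (i \<otimes> a)" "v = e (j \<otimes> a)"
        using uv unfolding L_def by blast
      then have "u \<oplus>\<^bsub>?N'\<^esub> v = e ((i \<oplus> j) \<otimes> a)" using ac by (simp add: simps l_distr)
      moreover have "i \<oplus> j \<in> I" using ij by simp
      ultimately show ?thesis unfolding L_def by auto
    qed
    show "\<one>\<^bsub>add_monoid ?N'\<^esub> \<in> L"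
      unfolding L_def using ac by (auto simp: simps intro!: imageI exI[of _ \<zero>])
    show "inv\<^bsub>add_monoid ?N'\<^esub> u \<in> L" if u: "u \<in> L" for u
    proof -
      obtain i where i: "i \<in> I" "u = e (i \<otimes> a)" using u unfolding L_def by blast
      have un: "e (i \<otimes> a) \<in> carrier ?N'" "e (\<ominus> i \<otimes> a) \<in> carrier ?N'"
        using i I.Icarr by (auto simp: simps cgenideal_def intro!: imageI)
      have "e (\<ominus> i \<otimes> a) \<oplus>\<^bsub>?N'\<^esub> e (i \<otimes> a) = \<zero>\<^bsub>?N'\<^esub>"
        using i ac I.Icarr by (simp add: simps l_distr[symmetric] l_neg)
      then have "\<ominus>\<^bsub>?N'\<^esub> e (i \<otimes> a) = e (\<ominus> i \<otimes> a)"
        using un by (intro N'.M.minus_equality)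
      then have "inv\<^bsub>add_monoid ?N'\<^esub> u = e (\<ominus> i \<otimes> a)" unfolding i(2) a_inv_def .
      moreover have "\<ominus> i \<in> I" using i by simp
      ultimately show ?thesis unfolding L_def by blast
    qed
  qed
  have "e a \<in> L"
  proof (rule tensor_kernel_imp_mem[OF R I N' L _ ea tK])
    fix i n assume i: "i \<in> I" and "n \<in> carrier ?N'"
    then obtain r where r: "r \<in> carrier R" "n = e (r \<otimes> a)" by (auto simp: simps cgenideal_def)
    then have "i \<odot>\<^bsub>?N'\<^esub> n = e ((i \<otimes> r) \<otimes> a)" using i I.Icarr ac by (simp add: simps m_assoc)
    moreover have "i \<otimes> r \<in> I" using i r I.I_r_closed by simp
    ultimately show "i \<odot>\<^bsub>?N'\<^esub> n \<in> L" unfolding L_def by blast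
  qed
  then obtain i where "i \<in> I" "e a = e (i \<otimes> a)" unfolding L_def by blast
  then have "i \<otimes> a = a" using e ac I.Icarr by (auto dest: inj_onD)
  with \<open>i \<in> I\<close> show "\<exists>b\<in>I. b \<otimes> a = a" by blast
qed

lemma pure_ideal_iff_s_unital:
  fixes R :: "('a, 'm) ring_scheme"
  assumes R: "cring R" and universe: "carrier R \<lesssim> (UNIV :: 'u set)"
  shows "pure_ideal TYPE('u) R I \<longleftrightarrow> ideal I R \<and> s_unital R I"
  using s_unital_of_flat_quotient[OF R _ universe]
    flat_quotient_of_s_unital[OF R] ideal.rcos_ring_hom[of I R]
  unfolding pure_ideal_def flat_ring_hom_def by blast


section \<open>s-Unital ideals of reduced mp-rings\<close>

lemma mp_ring_minimal_unique:
  assumes "mp_ring R" "P \<in> Spec R" "p \<in> Min_Spec R" "p \<subseteq> P" "q \<in> Min_Spec R" "q \<subseteq> P"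
  shows "q = p"
proof -
  have "\<exists>!p. p \<in> Min_Spec R \<and> p \<subseteq> P" using assms(1,2) unfolding mp_ring_def by blast
  then obtain r where "\<And>p. p \<in> Min_Spec R \<and> p \<subseteq> P \<Longrightarrow> p = r" by (elim ex1E) blast
  from this[OF conjI[OF assms(3,4)]] this[OF conjI[OF assms(5,6)]] show ?thesis by simp
qed

text \<open>
If \<open>a\<close> is not killed by any element outside \<open>M\<close>, then, as the ring is reduced, no product \<open>s a\<^sup>n\<close>
with \<open>s \<notin> M\<close> vanishes. A prime avoiding all these products lies below \<open>M\<close> and does not contain \<open>a\<close>,
so neither does the minimal prime inside it; but \<open>p\<close> is the only minimal prime below \<open>M\<close>.
\<close>

lemma minimal_prime_annihilator:
  fixes R (structure)
  assumes "reduced_ring R" "mp_ring R" and M: "M \<in> Spec R"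
    and p: "p \<in> Min_Spec R" "p \<subseteq> M" and a: "a \<in> p"
  shows "\<exists>s\<in>carrier R - M. s \<otimes> a = \<zero>"
proof (rule ccontr)
  assume ann: "\<not> (\<exists>s\<in>carrier R - M. s \<otimes> a = \<zero>)"
  interpret cring R using assms(1) unfolding reduced_ring_def by blast
  interpret M: primeideal M R using M unfolding Spec_def by simp
  have ac: "a \<in> carrier R" using p a M.Icarr by blast
  define S where "S = {s \<otimes> a [^] n | s n. s \<in> carrier R - M \<and> (n::nat) \<in> UNIV}"
  have one: "\<one> \<in> carrier R - M" using M.one_imp_carrier M.I_notcarr by auto
  have S: "S \<subseteq> carrier R" "\<one> \<in> S"
    unfolding S_def using ac one by (auto intro!: exI[of _ \<one>] exI[of _ "0::nat"])
  have mult: "s \<otimes> t \<in> S" if "s \<in> S" "t \<in> S" for s t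
  proof -
    obtain s' n t' k where *: "s' \<in> carrier R - M" "t' \<in> carrier R - M"
      "s = s' \<otimes> a [^] (n::nat)" "t = t' \<otimes> a [^] (k::nat)" using \<open>s \<in> S\<close> \<open>t \<in> S\<close> unfolding S_def by blast
    have "s \<otimes> t = (s' \<otimes> t') \<otimes> (a [^] n \<otimes> a [^] k)"
      using * ac by (simp add: m_ac)
    also have "a [^] n \<otimes> a [^] k = a [^] (n + k)" using ac by (simp add: nat_pow_mult)
    finally have "s \<otimes> t = (s' \<otimes> t') \<otimes> a [^] (n + k)" .
    moreover have "s' \<otimes> t' \<in> carrier R - M" using * M.I_prime by auto
    ultimately show ?thesis unfolding S_def by blast
  qed
  have "\<zero> \<notin> S"
  proof
    assume "\<zero> \<in> S"
    then obtain s and n :: nat where s: "s \<in> carrier R" "s \<notin> M" "s \<otimes> a [^] n = \<zero>"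
      unfolding S_def by auto
    have "(s \<otimes> a) [^] Suc n = (s [^] n \<otimes> a) \<otimes> (s \<otimes> a [^] n)"
      using s(1) ac by (simp add: nat_pow_distrib m_ac)
    also have "\<dots> = \<zero>" unfolding s(3) using s(1) ac by simp
    finally have "s \<otimes> a = \<zero>"
      using assms(1) s(1) ac unfolding reduced_ring_def by blast
    with ann s show False by blast
  qed
  then have "\<exists>Q\<in>Spec R. {\<zero>} \<subseteq> Q \<and> Q \<inter> S = {}"
    by (intro exists_prime_avoiding zeroideal S mult) auto
  then obtain Q where Q: "Q \<in> Spec R" "Q \<inter> S = {}" by blast
  interpret Q: primeideal Q R using Q unfolding Spec_def by simp
  have "Q \<subseteq> M"
  proof
    fix x assume x: "x \<in> Q"
    show "x \<in> M"
    proof (rule ccontr)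
      assume "x \<notin> M"
      then have "x \<otimes> a [^] (0::nat) \<in> S" unfolding S_def using Q.Icarr x by blast
      then show False using Q x Q.Icarr by auto
    qed
  qed
  moreover obtain q where q: "q \<in> Min_Spec R" "q \<subseteq> Q"
    using assms(2) Q unfolding mp_ring_def by blast
  ultimately have "q = p" using mp_ring_minimal_unique[OF assms(2) M p] by blast
  then have "a \<in> Q" using q a by blast
  moreover have "\<one> \<otimes> a [^] (1::nat) \<in> S" unfolding S_def using one by blast
  ultimately show False using Q ac by auto
qed

text \<open>
If no minimal prime lies in \<open>E\<close>, then \<open>J\<close> is the whole ring, by the intersection with the carrier.
The element \<open>b\<close> with \<open>b a = a\<close> comes from \<open>Ann(a) + J\<close> being the whole ring; \<open>N\<close> below is \<open>Ann(a)\<close>.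
\<close>

lemma s_unital_of_flat_closed:
  fixes R (structure)
  assumes "reduced_ring R" "mp_ring R" and E: "closedin (flat_topology R) E"
  defines "J \<equiv> carrier R \<inter> \<Inter>(Min_Spec R \<inter> E)"
  shows "ideal J R" "s_unital R J"
proof -
  interpret cring R using assms(1) unfolding reduced_ring_def by blast
  have "ideal (\<Inter>(insert (carrier R) (Min_Spec R \<inter> E))) R"
    using oneideal primeideal.axioms(1) unfolding Min_Spec_def Spec_def
    by (intro i_Intersect) auto
  then show J: "ideal J R" unfolding J_def by simp
  interpret J: ideal J R by fact
  show "s_unital R J"
    unfolding s_unital_def
  proof
    fix a assume a: "a \<in> J"
    have ac: "a \<in> carrier R" using a by (rule J.Icarr)
    define N where "N = {x \<in> carrier R. x \<otimes> a = \<zero>}"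
    have N: "ideal N R"
    proof (intro idealI ring_axioms subgroup.intro)
      show "inv\<^bsub>add_monoid R\<^esub> x \<in> N" if "x \<in> N" for x
        using that ac unfolding N_def a_inv_def[symmetric] by (simp add: l_minus)
    next
      show "x \<otimes> b \<in> N" "b \<otimes> x \<in> N" if "b \<in> N" "x \<in> carrier R" for b x
        using that ac by (auto simp: N_def m_assoc m_lcomm[of b x a])
    qed (use ac in \<open>auto simp: N_def l_distr\<close>)
    interpret N: ideal N R by fact
    have NJ: "ideal (N <+>\<^bsub>R\<^esub> J) R" by (intro add_ideals N J)
    have "\<one> \<in> N <+>\<^bsub>R\<^esub> J"
    proof (rule ccontr)
      assume "\<one> \<notin> N <+>\<^bsub>R\<^esub> J"
      then have "\<exists>M\<in>Spec R. N <+>\<^bsub>R\<^esub> J \<subseteq> M \<and> M \<inter> {\<one>} = {}"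
        by (intro exists_prime_avoiding NJ) auto
      then obtain M where M: "M \<in> Spec R" "N <+>\<^bsub>R\<^esub> J \<subseteq> M" by blast
      have "N \<subseteq> M"
      proof
        fix x assume x: "x \<in> N"
        then have "x = x \<oplus> \<zero>" using N.Icarr by auto
        then show "x \<in> M" using M(2) x J.zero_closed unfolding set_add_def' by blast
      qed
      have "J \<subseteq> M"
      proof
        fix x assume x: "x \<in> J"
        then have "x = \<zero> \<oplus> x" using J.Icarr by auto
        then show "x \<in> M" using M(2) x N.zero_closed unfolding set_add_def' by blast
      qed
      obtain p where p: "p \<in> Min_Spec R" "p \<subseteq> M"
        using assms(2) M(1) unfolding mp_ring_def by blast
      have "a \<notin> p"
      proof
        assume "a \<in> p"
        then obtain s where "s \<in> carrier R" "s \<notin> M" "s \<otimes> a = \<zero>"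
          using minimal_prime_annihilator[OF assms(1,2) M(1) p] by blast
        with \<open>N \<subseteq> M\<close> show False unfolding N_def by blast
      qed
      with a p have "p \<notin> E" unfolding J_def by blast
      have "\<not> P \<subseteq> M" if "P \<in> E" for P
      proof
        assume "P \<subseteq> M"
        have "P \<in> Spec R"
          using closedin_subset[OF E] topspace_flat_topology[OF is_cring] that by auto
        then obtain q where q: "q \<in> Min_Spec R" "q \<subseteq> P"
          using assms(2) unfolding mp_ring_def by blast
        then have "q = p" using mp_ring_minimal_unique[OF assms(2) M(1) p] \<open>P \<subseteq> M\<close> by blast
        moreover have "q \<in> E"
          using flat_closed_generization[OF is_cring E that _ q(2)] q(1) unfolding Min_Spec_def by blast
        ultimately show False using \<open>p \<notin> E\<close> by blast
      qed
      then obtain c where "c \<in> carrier R" "c \<notin> M" "\<And>P. P \<in> E \<Longrightarrow> c \<in> P"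
        using flat_closed_common_element[OF E M(1)] by blast
      with \<open>J \<subseteq> M\<close> show False unfolding J_def by blast
    qed
    then obtain s b where sb: "s \<in> N" "b \<in> J" "\<one> = s \<oplus> b"
      unfolding set_add_def' by blast
    have "a = (s \<oplus> b) \<otimes> a" unfolding sb(3)[symmetric] using ac by simp
    also have "\<dots> = b \<otimes> a"
      using sb ac J.Icarr unfolding N_def by (simp add: l_distr)
    finally show "\<exists>b\<in>J. b \<otimes> a = a" using sb(2) by metis
  qed
qed

text \<open>
Both claims rest on \<open>(1 - b) a = 0\<close>, the meaning of \<open>b a = a\<close>: a prime that avoids \<open>1 - b\<close> must
contain \<open>a\<close>, and if \<open>b\<close> fixes a power of \<open>a\<close>, then \<open>(1 - b) a\<close> is nilpotent, hence zero.
\<close>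

lemma flat_closed_of_s_unital:
  fixes R (structure)
  assumes "reduced_ring R" "mp_ring R" "ideal I R" "s_unital R I"
  defines "E \<equiv> {P \<in> Spec R. I \<subseteq> P}"
  shows "closedin (flat_topology R) E" "I = carrier R \<inter> \<Inter>(Min_Spec R \<inter> E)"
proof -
  interpret cring R using assms(1) unfolding reduced_ring_def by blast
  interpret I: ideal I R by fact
  have top: "topspace (flat_topology R) = Spec R" by (rule topspace_flat_topology) (rule is_cring)
  have compl: "(\<one> \<ominus> b) \<otimes> a = \<zero>" if "a \<in> carrier R" "b \<in> carrier R" "b \<otimes> a = a" for a b
  proof -
    have "(\<one> \<ominus> b) \<otimes> a = a \<ominus> b \<otimes> a" using that(1,2) by algebra
    then show ?thesis using that by (simp add: r_neg a_minus_def)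
  qed
  have avoid: "I \<subseteq> P \<longleftrightarrow> (\<forall>b\<in>I. \<one> \<ominus> b \<notin> P)" if "P \<in> Spec R" for P
  proof
    interpret P: primeideal P R using that unfolding Spec_def by simp
    show "\<forall>b\<in>I. \<one> \<ominus> b \<notin> P" if "I \<subseteq> P"
    proof (intro ballI notI)
      fix b assume b: "b \<in> I" "\<one> \<ominus> b \<in> P"
      then have "(\<one> \<ominus> b) \<oplus> b \<in> P" using that by blast
      moreover have "(\<one> \<ominus> b) \<oplus> b = \<one>" using I.Icarr[OF b(1)] by algebra
      ultimately show False using P.one_imp_carrier P.I_notcarr by auto
    qed
    show "I \<subseteq> P" if *: "\<forall>b\<in>I. \<one> \<ominus> b \<notin> P"
    proof
      fix a assume a: "a \<in> I"
      then obtain b where b: "b \<in> I" "b \<otimes> a = a" using assms(4) unfolding s_unital_def by blast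
      have "(\<one> \<ominus> b) \<otimes> a = \<zero>" using compl a b I.Icarr by blast
      then have "(\<one> \<ominus> b) \<otimes> a \<in> P" using P.zero_closed by simp
      then show "a \<in> P" using P.I_prime[of "\<one> \<ominus> b" a] * b a I.Icarr by auto
    qed
  qed
  have "openin (flat_topology R) (\<Union>b\<in>I. {P \<in> Spec R. \<one> \<ominus> b \<in> P})"
    using I.Icarr unfolding flat_topology_def
    by (intro openin_Union) (auto intro!: topology_generated_by_Basis)
  moreover have "Spec R - E = (\<Union>b\<in>I. {P \<in> Spec R. \<one> \<ominus> b \<in> P})"
    unfolding E_def using avoid by blast
  ultimately show E: "closedin (flat_topology R) E"
    unfolding closedin_def top by (auto simp: E_def)
  show "I = carrier R \<inter> \<Inter>(Min_Spec R \<inter> E)"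
  proof
    show "I \<subseteq> carrier R \<inter> \<Inter>(Min_Spec R \<inter> E)" using I.Icarr unfolding E_def by blast
    show "carrier R \<inter> \<Inter>(Min_Spec R \<inter> E) \<subseteq> I"
    proof (rule subsetI, rule ccontr)
      fix a assume a: "a \<in> carrier R \<inter> \<Inter>(Min_Spec R \<inter> E)" "a \<notin> I"
      then have ac: "a \<in> carrier R" by blast
      define S where "S = {a [^] n | n::nat. True}"
      have S: "S \<subseteq> carrier R" "\<one> \<in> S" unfolding S_def using ac by (auto intro!: exI[of _ "0::nat"])
      have mult: "s \<otimes> t \<in> S" if "s \<in> S" "t \<in> S" for s t
        using that ac nat_pow_mult unfolding S_def by blast
      have "I \<inter> S = {}"
      proof (rule ccontr)
        assume "I \<inter> S \<noteq> {}"
        then obtain n :: nat where n: "a [^] n \<in> I" unfolding S_def by blast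
        then obtain b where b: "b \<in> I" "b \<otimes> a [^] n = a [^] n"
          using assms(4) unfolding s_unital_def by blast
        have bc: "b \<in> carrier R" using b I.Icarr by blast
        let ?c = "\<one> \<ominus> b"
        have c: "?c \<in> carrier R" using bc by simp
        have "(?c \<otimes> a) [^] Suc n = (?c [^] n \<otimes> a) \<otimes> (?c \<otimes> a [^] n)"
          using c ac by (simp add: nat_pow_distrib m_ac)
        also have "?c \<otimes> a [^] n = \<zero>" using compl b bc ac by simp
        finally have "(?c \<otimes> a) [^] Suc n = \<zero>" using c ac by simp
        then have "?c \<otimes> a = \<zero>"
          using assms(1) c ac unfolding reduced_ring_def by blast
        moreover have "a = ?c \<otimes> a \<oplus> b \<otimes> a" using ac bc by algebra
        ultimately have "a = b \<otimes> a" using ac bc by simp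
        then show False using a(2) I.I_r_closed[OF b(1) ac] by simp
      qed
      then have "\<exists>P\<in>Spec R. I \<subseteq> P \<and> P \<inter> S = {}"
        by (intro exists_prime_avoiding assms(3) S mult)
      then obtain P where P: "P \<in> Spec R" "I \<subseteq> P" "P \<inter> S = {}" by blast
      then obtain q where q: "q \<in> Min_Spec R" "q \<subseteq> P"
        using assms(2) unfolding mp_ring_def by blast
      have "q \<in> E"
        using flat_closed_generization[OF is_cring E _ _ q(2)] q(1) P unfolding E_def Min_Spec_def by blast
      then have "a \<in> P" using a q by blast
      moreover have "a [^] (1::nat) \<in> S" unfolding S_def by blast
      ultimately show False using P(3) ac by auto
    qed
  qed
qed


section \<open>Pure ideals of reduced mp-rings\<close>

theorem theorem7p3:
  fixes A :: "('a, 'm) ring_scheme"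
  assumes "reduced_ring A" and "mp_ring A"
    and universe: "carrier A \<lesssim> (UNIV :: 'u set)"
  shows "{I. pure_ideal TYPE('u) A I} =
    {carrier A \<inter> \<Inter>(Min_Spec A \<inter> E) | E. closedin (flat_topology A) E}"
proof -
  have "cring A" using assms(1) unfolding reduced_ring_def by blast
  note pure = pure_ideal_iff_s_unital[OF this universe]
  show ?thesis
  proof (intro subset_antisym subsetI)
    fix I assume "I \<in> {I. pure_ideal TYPE('u) A I}"
    then have "ideal I A" "s_unital A I" using pure by simp_all
    from flat_closed_of_s_unital[OF assms(1,2) this]
    show "I \<in> {carrier A \<inter> \<Inter>(Min_Spec A \<inter> E) | E. closedin (flat_topology A) E}" by blast
  next
    fix I assume "I \<in> {carrier A \<inter> \<Inter>(Min_Spec A \<inter> E) | E. closedin (flat_topology A) E}"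
    then obtain E where E: "closedin (flat_topology A) E" "I = carrier A \<inter> \<Inter>(Min_Spec A \<inter> E)" by blast
    show "I \<in> {I. pure_ideal TYPE('u) A I}"
      using s_unital_of_flat_closed[OF assms(1,2) E(1)] pure E(2) by simp
  qed
qed

end
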